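(* Let $G$ be a simple graph with $n$ vertices, maximum degree $\Delta$, minimum degree $\delta$, and let $N_\Delta$, $N_\delta$ be the numbers of vertices of degree $\Delta$ and $\delta$. Then $$\mathrm{Var}(G)\ge \frac{(N_\delta+N_\Delta)^2}{n^4}\,IRR(G)\,IRD(G),$$ with equality if and only if $G$ has at most two distinct vertex degrees.
   Context: With $m$ the number of edges and $d_1,\dots,d_n$ the degrees, $\mathrm{Var}(G)=\frac1n\sum_{i=1}^n\left(d_i-\frac{2m}{n}\right)^2$, $IRR(G)=\frac n2(\Delta-\delta)$, and $IRD(G)=\frac{2N_\Delta N_\delta}{N_\delta+N_\Delta}(\Delta-\delta)$. *)

theory Defs
  imports Complex_Main "Graph_Theory.Digraph"
begin

text \<open>
  The locale predicate \<^const>\<open>graph\<close> describes finite simple graphs as finite, loop-free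
  symmetric digraphs without parallel arcs. An undirected edge is thus represented by a pair of
  opposite arcs, so the edges are counted as unordered pairs of end points, and the degree of a
  vertex is its out-degree.
\<close>

definition uedges :: "('a, 'b) pre_digraph \<Rightarrow> 'a set set" where
  "uedges G = (\<lambda>e. {tail G e, head G e}) ` arcs G"

definition degree :: "('a, 'b) pre_digraph \<Rightarrow> 'a \<Rightarrow> nat" where
  "degree G v = out_degree G v"

definition degrees :: "('a, 'b) pre_digraph \<Rightarrow> nat set" where
  "degrees G = degree G ` verts G"

definition max_degree :: "('a, 'b) pre_digraph \<Rightarrow> nat" where
  "max_degree G = Max (degrees G)"

definition min_degree :: "('a, 'b) pre_digraph \<Rightarrow> nat" where
  "min_degree G = Min (degrees G)"

definition num_degree :: "('a, 'b) pre_digraph \<Rightarrow> nat \<Rightarrow> nat" where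
  "num_degree G k = card {v \<in> verts G. degree G v = k}"

definition Var :: "('a, 'b) pre_digraph \<Rightarrow> real" where
  "Var G = 1 / real (card (verts G)) *
     (\<Sum>v\<in>verts G. (real (degree G v) - 2 * real (card (uedges G)) / real (card (verts G)))\<^sup>2)"

definition IRR :: "('a, 'b) pre_digraph \<Rightarrow> real" where
  "IRR G = real (card (verts G)) / 2 * (real (max_degree G) - real (min_degree G))"

text \<open>
  For a regular graph the two vertex counts below coincide; the difference factor is then zero.
\<close>

definition IRD :: "('a, 'b) pre_digraph \<Rightarrow> real" where
  "IRD G =
     2 * real (num_degree G (max_degree G)) * real (num_degree G (min_degree G)) /
       (real (num_degree G (min_degree G)) + real (num_degree G (max_degree G))) *
     (real (max_degree G) - real (min_degree G))"

end

theory Submission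
  imports Defs
begin

text \<open>
  Write \<open>a\<close>, \<open>b\<close> for the numbers of vertices of maximum and minimum degree, \<open>x\<close>, \<open>y\<close> for the
  deviations of these two degrees from the mean, and \<open>D = x - y\<close>. The right-hand side equals
  \<open>(a + b) a b D\<^sup>2 / n\<^sup>3\<close>. Keeping only the extreme vertices in the variance gives
  \<open>n Var \<ge> a x\<^sup>2 + b y\<^sup>2 \<ge> a b D\<^sup>2 / (a + b)\<close>, and \<open>a + b \<le> n\<close> finishes the inequality, strictly
  if \<open>D \<noteq> 0\<close> and \<open>a + b < n\<close>. If \<open>a + b = n\<close>, nothing is discarded in the first step, and the
  handshake lemma gives \<open>a x + b y = 0\<close>, which is the equality case of the second.
\<close>

text \<open>Each fibre of the map from arcs to end-point sets is an arc with its reverse: symmetry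
  supplies the reverse, the absence of parallel arcs excludes a third member, and the absence of
  loops keeps the two distinct.\<close>

lemma (in graph) card_arcs_eq_2_uedges: "card (arcs G) = 2 * card (uedges G)"
proof -
  let ?g = "\<lambda>e. {tail G e, head G e}"
  have fibre: "card {a \<in> arcs G. ?g a = u} = 2" if "u \<in> uedges G" for u
  proof -
    from that obtain e where e: "e \<in> arcs G" "u = ?g e"
      unfolding uedges_def by blast
    obtain e' where e': "e' \<in> arcs G" "tail G e = head G e'" "head G e = tail G e'"
      using sym_arcs e(1) unfolding symmetric_conv by blast
    have "a = e \<or> a = e'" if "a \<in> arcs G" "?g a = u" for a
      using that e e' no_multi_arcs[of a e] no_multi_arcs[of a e']
      by (auto simp: arc_to_ends_def doubleton_eq_iff)
    then have "{a \<in> arcs G. ?g a = u} = {e, e'}"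
      using e e' by auto
    moreover have "e \<noteq> e'"
      using e'(2) no_loops[OF e(1)] by auto
    ultimately show ?thesis by simp
  qed
  have "card (arcs G) = (\<Sum>u\<in>uedges G. card {a \<in> arcs G. ?g a = u})"
    using sum.image_gen[OF finite_arcs, of "\<lambda>_. 1::nat" ?g] by (simp add: uedges_def)
  then show ?thesis
    using fibre by simp
qed

lemma (in fin_digraph) sum_degree: "(\<Sum>v\<in>verts G. degree G v) = card (arcs G)"
proof -
  have "card (arcs G) = (\<Sum>v\<in>verts G. \<Sum>e\<in>{e \<in> arcs G. tail G e = v}. 1)"
    using sum.group[OF finite_arcs finite_verts, of "tail G" "\<lambda>_. 1::nat"]
    by (simp add: image_subset_iff)
  then show ?thesis
    by (simp add: degree_def out_degree_def out_arcs_def)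
qed

text \<open>Lagrange's identity for the vectors \<open>(sqrt a, sqrt b)\<close> and
  \<open>(sqrt a * x, sqrt b * y)\<close> when the weights are nonnegative. The last square is the
  defect of the Cauchy-Schwarz type bound obtained by dropping it.\<close>

lemma weighted_two_squares:
  fixes a b x y :: real
  shows "(a + b) * (a * x\<^sup>2 + b * y\<^sup>2) = a * b * (x - y)\<^sup>2 + (a * x + b * y)\<^sup>2"
  by algebra

text \<open>Distinct degrees give disjoint classes, on each of which the summand is constant.
  Different choices of \<open>f\<close> yield the size of the union, its total deviation and its sum
  of squared deviations.\<close>

lemma (in fin_digraph) sum_two_degree_classes:
  fixes f :: "nat \<Rightarrow> real"
  assumes "k \<noteq> l"
  shows "(\<Sum>v\<in>{v \<in> verts G. degree G v = k \<or> degree G v = l}. f (degree G v))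
    = num_degree G k * f k + num_degree G l * f l"
proof -
  have "{v \<in> verts G. degree G v = k \<or> degree G v = l}
      = {v \<in> verts G. degree G v = k} \<union> {v \<in> verts G. degree G v = l}" by auto
  moreover have "(\<Sum>v\<in>{v \<in> verts G. degree G v = j}. f (degree G v)) = num_degree G j * f j" for j
    by (simp add: num_degree_def)
  ultimately show ?thesis
    using assms by (simp add: sum.union_disjoint disjoint_iff num_degree_def)
qed

theorem theorem5:
  fixes G :: "('a, 'b) pre_digraph"
    and n \<Delta> \<delta> N\<^sub>\<Delta> N\<^sub>\<delta> :: nat
  assumes "graph G"
    and "verts G \<noteq> {}"
    and "n = card (verts G)"
    and "\<Delta> = max_degree G"
    and "\<delta> = min_degree G"
    and "N\<^sub>\<Delta> = num_degree G \<Delta>"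
    and "N\<^sub>\<delta> = num_degree G \<delta>"
  shows "Var G \<ge> (real N\<^sub>\<delta> + real N\<^sub>\<Delta>)\<^sup>2 / real n ^ 4 * IRR G * IRD G \<and>
    (Var G = (real N\<^sub>\<delta> + real N\<^sub>\<Delta>)\<^sup>2 / real n ^ 4 * IRR G * IRD G
      \<longleftrightarrow> card (degrees G) \<le> 2)"
proof -
  interpret graph G by fact
  define a b where "a = real N\<^sub>\<Delta>" and "b = real N\<^sub>\<delta>"
  define \<mu> where "\<mu> = 2 * real (card (uedges G)) / real n"
  define D where "D = real \<Delta> - real \<delta>"
  define S where "S = (\<Sum>v\<in>verts G. (real (degree G v) - \<mu>)\<^sup>2)"
  define R where "R = (real N\<^sub>\<delta> + real N\<^sub>\<Delta>)\<^sup>2 / real n ^ 4 * IRR G * IRD G"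
  define E where "E = {v \<in> verts G. degree G v = \<Delta> \<or> degree G v = \<delta>}"
  have fin: "finite (degrees G)" and ne: "degrees G \<noteq> {}"
    using assms(2) by (auto simp: degrees_def)
  have \<Delta>: "\<Delta> \<in> degrees G" and \<delta>: "\<delta> \<in> degrees G"
    using fin ne assms(4,5) by (auto simp: max_degree_def min_degree_def)
  have bounds: "k \<le> \<Delta>" "\<delta> \<le> k" if "k \<in> degrees G" for k
    using that fin assms(4,5) by (auto simp: max_degree_def min_degree_def)
  have n: "real n > 0"
    using assms(2,3) by (simp add: card_gt_0_iff)
  have pos: "a > 0" "b > 0"
    using \<Delta> \<delta> assms(6,7) by (auto simp: a_def b_def num_degree_def card_gt_0_iff degrees_def)
  have Var: "Var G = S / n"
    using assms(3) by (simp add: Var_def S_def \<mu>_def)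
  have R: "R = (a + b) * a * b * D\<^sup>2 / n ^ 3"
  proof -
    \<comment> \<open>Naming the sum keeps it atomic, so that it cancels instead of being multiplied
      out.\<close>
    define s where "s = a + b"
    have "s \<noteq> 0" using pos by (simp add: s_def)
    have "IRR G = n / 2 * D"
      by (simp add: IRR_def D_def assms(3-5))
    moreover have "IRD G = 2 * a * b / s * D"
      by (simp add: IRD_def D_def a_def b_def s_def assms(4-7) add.commute)
    ultimately have "R = s\<^sup>2 / real n ^ 4 * (n / 2 * D) * (2 * a * b / s * D)"
      by (simp add: R_def a_def b_def s_def add.commute)
    also have "\<dots> = s * a * b * D\<^sup>2 / n ^ 3"
      using n \<open>s \<noteq> 0\<close> by (simp add: field_simps power2_eq_square power3_eq_cube power4_eq_xxxx)
    finally show ?thesis by (simp add: s_def)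
  qed
  have mean: "(\<Sum>v\<in>verts G. real (degree G v) - \<mu>) = 0"
  proof -
    have "(\<Sum>v\<in>verts G. real (degree G v)) = 2 * real (card (uedges G))"
      using sum_degree card_arcs_eq_2_uedges by (simp flip: of_nat_sum)
    then show ?thesis
      using n by (simp add: sum_subtractf \<mu>_def flip: assms(3))
  qed
  have "Var G \<ge> R \<and> (Var G = R \<longleftrightarrow> card (degrees G) \<le> 2)"
  \<comment> \<open>In a regular graph the two extreme classes coincide and \<open>a + b\<close>
    counts every vertex twice, so this case is separate; both sides are then zero.\<close>
  proof (cases "\<Delta> = \<delta>")
    case True
    have "k = \<Delta>" if "k \<in> degrees G" for k
      using bounds[OF that] True by simp
    then have deg: "degrees G = {\<Delta>}" using \<Delta> by blast
    then have "degree G v = \<Delta>" if "v \<in> verts G" for v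
      using that unfolding degrees_def by blast
    then have "real \<Delta> = \<mu>" and "S = n * (real \<Delta> - \<mu>)\<^sup>2"
      using mean n assms(2,3) by (simp_all add: S_def)
    then show ?thesis
      using True deg by (simp add: Var R D_def)
  next
    case False
    let ?x = "real \<Delta> - \<mu>" and ?y = "real \<delta> - \<mu>"
    have D: "D \<noteq> 0" "D = ?x - ?y" using False by (auto simp: D_def)
    have E: "E \<subseteq> verts G" "finite E" by (auto simp: E_def)
    have sumE: "(\<Sum>v\<in>E. f (degree G v)) = a * f \<Delta> + b * f \<delta>" for f :: "nat \<Rightarrow> real"
      using sum_two_degree_classes[OF False, of f] by (simp add: E_def a_def b_def assms(6,7))
    have cardE: "real (card E) = a + b"
      using sumE[of "\<lambda>_. 1"] by simp
    have SE: "(\<Sum>v\<in>E. (real (degree G v) - \<mu>)\<^sup>2) = a * ?x\<^sup>2 + b * ?y\<^sup>2"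
      using sumE[of "\<lambda>k. (real k - \<mu>)\<^sup>2"] by simp
    have "a * ?x\<^sup>2 + b * ?y\<^sup>2 \<le> S"
      unfolding S_def SE[symmetric] using E by (intro sum_mono2) auto
    then have "(a + b) * (a * ?x\<^sup>2 + b * ?y\<^sup>2) \<le> (a + b) * S"
      using pos by (intro mult_left_mono) auto
    then have low: "a * b * D\<^sup>2 \<le> (a + b) * S"
      unfolding weighted_two_squares D(2)
      using zero_le_power2[of "a * ?x + b * ?y"] by linarith
    \<comment> \<open>Over the common positive denominator \<open>n ^ 3\<close> only the numerators
      have to be compared.\<close>
    have cmp: "(R < Var G) = ((a + b) * (a * b * D\<^sup>2) < n\<^sup>2 * S)"
      "(R = Var G) = ((a + b) * (a * b * D\<^sup>2) = n\<^sup>2 * S)"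
    proof -
      have "R = (a + b) * (a * b * D\<^sup>2) / n ^ 3" "Var G = n\<^sup>2 * S / n ^ 3"
        using n by (simp_all add: R Var power2_eq_square power3_eq_cube)
      then show "(R < Var G) = ((a + b) * (a * b * D\<^sup>2) < n\<^sup>2 * S)"
        "(R = Var G) = ((a + b) * (a * b * D\<^sup>2) = n\<^sup>2 * S)"
        using n by (simp_all only: divide_less_cancel divide_cancel_right) auto
    qed
    \<comment> \<open>Both extreme degrees occur and they differ, so a set of at most two degrees
      consists of exactly these.\<close>
    have card_iff: "card (degrees G) \<le> 2 \<longleftrightarrow> E = verts G"
    proof
      assume "card (degrees G) \<le> 2"
      then have "{\<Delta>, \<delta>} = degrees G"
        using fin \<Delta> \<delta> False by (intro card_seteq) auto
      then show "E = verts G" by (auto simp: E_def degrees_def)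
    next
      assume "E = verts G"
      then have "degrees G \<subseteq> {\<Delta>, \<delta>}" by (auto simp: E_def degrees_def)
      from card_mono[OF _ this] show "card (degrees G) \<le> 2"
        using False by simp
    qed
    show ?thesis
    proof (cases "E = verts G")
      case True
      have "a * ?x + b * ?y = 0"
        using mean sumE[of "\<lambda>k. real k - \<mu>"] True by simp
      moreover have "S = a * ?x\<^sup>2 + b * ?y\<^sup>2"
        using SE True by (simp add: S_def)
      ultimately have "a * b * D\<^sup>2 = (a + b) * S"
        by (simp add: weighted_two_squares D(2))
      moreover have "a + b = n"
        using cardE True assms(3) by simp
      ultimately have "R = Var G"
        by (simp add: cmp power2_eq_square)
      then show ?thesis
        using True card_iff by simp
    next
      case False
      have "card E < n"
        using E False unfolding assms(3) by (intro psubset_card_mono) auto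
      then have less: "(a + b)\<^sup>2 < (real n)\<^sup>2"
        using pos cardE by (intro power_strict_mono) auto
      \<comment> \<open>Positivity of \<open>S\<close> is what lets the strict bound on
        \<open>(a + b)\<^sup>2\<close> survive multiplication by \<open>S\<close>.\<close>
      have "0 < a * b * D\<^sup>2" using pos D by simp
      then have "0 < (a + b) * S" using low by linarith
      then have S: "0 < S" using pos by (simp add: zero_less_mult_iff)
      have "(a + b) * (a * b * D\<^sup>2) \<le> (a + b) * ((a + b) * S)"
        using low pos by (intro mult_left_mono) auto
      also have "\<dots> = (a + b)\<^sup>2 * S" by (simp add: power2_eq_square)
      also have "\<dots> < (real n)\<^sup>2 * S" using less S by (rule mult_strict_right_mono)
      finally have "R < Var G" by (simp add: cmp)
      then show ?thesis
        using False card_iff by simp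
    qed
  qed
  then show ?thesis unfolding R_def .
qed

end
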